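(* (A) Let $X,Y,Z$ be $\mathbb{N}_0$-valued random variables with finite variances that are linearly independent, and suppose that for some non-negative coefficients $a_{ij}$, $i,j\in\{1,2,3\}$, $$\mathbb{E}[X\mid Y,Z]=a_{11}+a_{12}Y+a_{13}Z,\quad \mathbb{E}[Y\mid X,Z]=a_{22}+a_{21}X+a_{23}Z,\quad \mathbb{E}[Z\mid X,Y]=a_{33}+a_{31}X+a_{32}Y.$$ Then: (i) all pairwise conditional expectations $\mathbb{E}[X\mid Y]$, $\mathbb{E}[X\mid Z]$, $\mathbb{E}[Y\mid X]$, $\mathbb{E}[Y\mid Z]$, $\mathbb{E}[Z\mid X]$, $\mathbb{E}[Z\mid Y]$ are linear in the conditioning variable, and $$1-a_{12}a_{21}>0,\qquad 1-a_{23}a_{32}>0,\qquad 1-a_{13}a_{31}>0;$$ (ii) $$\begin{vmatrix}1&-a_{12}&-a_{13}\\-a_{21}&1&-a_{23}\\-a_{31}&-a_{32}&1\end{vmatrix}>0.$$ That is, all principal minors of this matrix are positive. (B) More generally, let $n\ge3$ and let $X=(X_1,\dots,X_n)$ be a linearly independent random vector such that each $X_i$ has finite second moment and, for some real coefficients $a_{ij}$, $$\mathbb{E}[X_i\mid X_j,\,j\ne i]=a_{ii}+\sum_{j\ne i}a_{ij}X_j,\qquad 1\le i\le n.$$ Then all principal minors of the $n\times n$ matrix with diagonal entries $1$ and $(i,j)$ entry $-a_{ij}$ for $i\ne j$ are positive, and for every subset $\{k_1,\dots,k_l\}$ of $\{1,\dots,n\}$ the subvector $(X_{k_1},\dots,X_{k_l})$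 is such that the conditional expectation of each of its components given the other components is linear in those other components.
   Context: $\mathbb{N}_0=\{0,1,2,\dots\}$. "Linear" means affine, i.e. a constant plus a linear combination of the conditioning variables; identities hold almost surely. A random vector $(X_1,\dots,X_n)$ is called linearly independent if no linear combination $\sum_i c_iX_i$ with $(c_1,\dots,c_n)\neq0$ is almost surely constant (equivalently, for finite second moments, its covariance matrix is positive definite). *)

theory Defs
  imports
    "HOL-Probability.Probability"
    "Jordan_Normal_Form.Determinant"
    "Jordan_Normal_Form.DL_Submatrix"
begin

text \<open>
  \<open>cond_exp_given M V N f\<close> is the conditional expectation of \<open>f\<close> given the \<open>N\<close>-valued random
  element \<open>V\<close>, i.e. given the sub-\<open>\<sigma>\<close>-algebra generated by \<open>V\<close>. As usual it is a fixed version,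
  so identities about it are only meaningful almost surely; it is the conditional expectation
  only if \<open>M\<close> is a probability space, \<open>V\<close> is measurable and \<open>f\<close> is integrable.
\<close>

definition cond_exp_given ::
  "'a measure \<Rightarrow> ('a \<Rightarrow> 'b) \<Rightarrow> 'b measure \<Rightarrow> ('a \<Rightarrow> real) \<Rightarrow> 'a \<Rightarrow> real" where
  "cond_exp_given M V N f = real_cond_exp M (vimage_algebra (space M) V N) f"

text \<open>
  Conditioning on the finite subfamily \<open>(X j)\<close>, \<open>j \<in> J\<close>, of real random variables. For \<open>J = {}\<close> the
  generated \<open>\<sigma>\<close>-algebra is the trivial one.
\<close>

definition cond_exp_family ::
  "'a measure \<Rightarrow> (nat \<Rightarrow> 'a \<Rightarrow> real) \<Rightarrow> nat set \<Rightarrow> ('a \<Rightarrow> real) \<Rightarrow> 'a \<Rightarrow> real" where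
  "cond_exp_family M X J f =
     cond_exp_given M (\<lambda>\<omega>. \<lambda>j\<in>J. X j \<omega>) (Pi\<^sub>M J (\<lambda>_. borel)) f"

definition lin_indep_rvs :: "'a measure \<Rightarrow> nat set \<Rightarrow> (nat \<Rightarrow> 'a \<Rightarrow> real) \<Rightarrow> bool" where
  "lin_indep_rvs M I X \<longleftrightarrow>
     (\<forall>c. (\<exists>i\<in>I. c i \<noteq> 0) \<longrightarrow> \<not> (\<exists>d. AE \<omega> in M. (\<Sum>i\<in>I. c i * X i \<omega>) = d))"

text \<open>
  The random variables and coefficients are indexed by \<open>1, \<dots>, n\<close>, whereas matrix indices start
  at \<open>0\<close>; hence the shift.
\<close>

definition coeff_matrix :: "nat \<Rightarrow> (nat \<Rightarrow> nat \<Rightarrow> real) \<Rightarrow> real mat" where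
  "coeff_matrix n a = mat n n (\<lambda>(i, j). if i = j then 1 else - a (Suc i) (Suc j))"

definition principal_minors_pos :: "real mat \<Rightarrow> bool" where
  "principal_minors_pos A \<longleftrightarrow>
     (\<forall>S. S \<subseteq> {..<dim_row A} \<and> S \<noteq> {} \<longrightarrow> 0 < Determinant.det (submatrix A S S))"

end

theory Submission
  imports Defs
begin

text \<open>
  The residual \<open>e\<^sub>i = X\<^sub>i - a\<^sub>i\<^sub>i - \<Sum>\<^sub>j a\<^sub>i\<^sub>j X\<^sub>j\<close> is centred and orthogonal to every \<open>X\<^sub>k\<close> with \<open>k \<noteq> i\<close>, so
  \<open>E[e\<^sub>i e\<^sub>k] = B\<^sub>i\<^sub>k d\<^sub>k\<close>, where \<open>B\<close> is the coefficient matrix and \<open>d\<^sub>k = E[e\<^sub>k X\<^sub>k] = E[e\<^sub>k\<^sup>2] > 0\<close>.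
  The residuals are linearly independent, hence \<open>B diag(d)\<close> is positive definite and all principal
  minors of \<open>B\<close> are positive. In particular \<open>1 - a\<^sub>i\<^sub>k a\<^sub>k\<^sub>i > 0\<close>, which makes it possible to eliminate
  one variable at a time from the regressions, by the tower property.
\<close>

section \<open>Determinants and principal minors under a positive weighted quadratic form\<close>

text \<open>The form is that of \<open>A diag(d)\<close>, on which no symmetry is imposed. The
  determinant is therefore controlled by deforming \<open>A\<close> to the identity: the form of
  \<open>diag(d)\<close> is positive too, so every convex combination of \<open>A\<close> and
  \<open>1\<close> is nonsingular.\<close>

lemma det_pos_if_weighted_form_pos:
  fixes A :: "real mat" and d :: "nat \<Rightarrow> real"
  assumes A: "A \<in> carrier_mat n n"
    and d: "\<And>i. i < n \<Longrightarrow> 0 < d i"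
    and form: "\<And>v. \<exists>i<n. v i \<noteq> 0 \<Longrightarrow> 0 < (\<Sum>i<n. \<Sum>j<n. v i * A $$ (i, j) * d j * v j)"
  shows "0 < Determinant.det A"
proof -
  define P where "P t = mat n n (\<lambda>(i, j). t * A $$ (i, j) + (1 - t) * (if i = j then 1 else 0))"
    for t :: real
  have P: "P t \<in> carrier_mat n n" for t
    by (simp add: P_def)
  txt \<open>Positivity of the form persists along the segment from \<open>1\<close> to \<open>A\<close>, so the determinant cannot
    change sign there.\<close>
  have nz: "Determinant.det (P t) \<noteq> 0" if t: "0 \<le> t" "t \<le> 1" for t
  proof
    assume "Determinant.det (P t) = 0"
    then obtain v where v: "v \<in> carrier_vec n" "v \<noteq> 0\<^sub>v n" "P t *\<^sub>v v = 0\<^sub>v n"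
      using det_0_iff_vec_prod_zero_field[OF P] by blast
    \<comment> \<open>Substituting \<open>v = diag(d) w\<close> and testing \<open>P t v = 0\<close>
      against \<open>w\<close> produces the weighted form at \<open>w\<close>: \<open>t\<close>
      times that of \<open>A\<close> plus \<open>1 - t\<close> times the sum of
      \<open>d i * w i * w i\<close>.\<close>
    define w where "w i = v $ i / d i" for i
    have dw: "d i * w i = v $ i" if "i < n" for i
      using d[OF that] by (simp add: w_def)
    obtain k where k: "k < n" "v $ k \<noteq> 0"
      using v(1,2) by (metis carrier_vecD eq_vecI index_zero_vec(1) index_zero_vec(2))
    then have wk: "w k \<noteq> 0"
      using d[of k] by (simp add: w_def)
    have "(\<Sum>j<n. P t $$ (i, j) * v $ j) = 0" if "i < n" for i
    proof -
      have "(P t *\<^sub>v v) $ i = (\<Sum>j<n. P t $$ (i, j) * v $ j)"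
        using that v(1) P[of t] by (auto simp: scalar_prod_def lessThan_atLeast0 intro!: sum.cong)
      then show ?thesis
        using that v(3) by simp
    qed
    then have "0 = (\<Sum>i<n. w i * (\<Sum>j<n. P t $$ (i, j) * v $ j))"
      by simp
    also have "\<dots> = (\<Sum>i<n. \<Sum>j<n. t * (w i * A $$ (i, j) * d j * w j)
        + (if i = j then (1 - t) * (d j * w j * w j) else 0))"
      unfolding sum_distrib_left
      by (intro sum.cong refl) (auto simp: P_def dw[symmetric] algebra_simps)
    also have "\<dots> = t * (\<Sum>i<n. \<Sum>j<n. w i * A $$ (i, j) * d j * w j)
        + (1 - t) * (\<Sum>i<n. d i * w i * w i)"
      by (simp add: sum.distrib sum_distrib_left)
    finally have eq: "t * (\<Sum>i<n. \<Sum>j<n. w i * A $$ (i, j) * d j * w j)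
        + (1 - t) * (\<Sum>i<n. d i * w i * w i) = 0" by simp
    have "0 < (\<Sum>i<n. \<Sum>j<n. w i * A $$ (i, j) * d j * w j)"
      using form k(1) wk by blast
    moreover have "0 < (\<Sum>i<n. d i * w i * w i)"
      using d k(1) wk by (intro sum_pos2[of _ k]) (auto simp: mult.assoc less_imp_le zero_less_mult_iff
          linorder_neq_iff)
    ultimately have "0 < t * (\<Sum>i<n. \<Sum>j<n. w i * A $$ (i, j) * d j * w j)
        + (1 - t) * (\<Sum>i<n. d i * w i * w i)"
      using t by (cases "t = 0") (auto intro!: add_pos_nonneg)
    then show False
      using eq by simp
  qed
  have cont: "continuous_on {0..1} (\<lambda>t. Determinant.det (P t))"
    unfolding det_def'[OF P]
    by (intro continuous_on_sum continuous_on_mult continuous_on_prod continuous_on_const)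
      (auto simp: P_def permutes_in_image intro!: continuous_intros)
  have "P 0 = 1\<^sub>m n" "P 1 = A"
    using A by (auto simp: P_def intro!: eq_matI)
  then have "Determinant.det (P 0) = 1" "Determinant.det (P 1) = Determinant.det A"
    by simp_all
  \<comment> \<open>If \<open>det A\<close> were at most 0, the intermediate value theorem between
    \<open>det (P 1) = det A\<close> and \<open>det (P 0) = 1\<close> would give a singular
    \<open>P t\<close>.\<close>
  then show ?thesis
    using IVT2'[of "\<lambda>t. Determinant.det (P t)" 1 0 0] cont nz by fastforce
qed

text \<open>A principal submatrix inherits the positive form: vectors on \<open>S\<close> are
  extended by zero, and the weights are restricted to \<open>S\<close>.\<close>

lemma principal_minors_pos_if_weighted_form_pos:
  fixes A :: "real mat" and d :: "nat \<Rightarrow> real"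
  assumes A: "A \<in> carrier_mat n n"
    and d: "\<And>i. i < n \<Longrightarrow> 0 < d i"
    and form: "\<And>v. \<exists>i<n. v i \<noteq> 0 \<Longrightarrow> 0 < (\<Sum>i<n. \<Sum>j<n. v i * A $$ (i, j) * d j * v j)"
  shows "principal_minors_pos A"
  unfolding principal_minors_pos_def
proof (intro allI impI)
  fix S assume "S \<subseteq> {..<dim_row A} \<and> S \<noteq> {}"
  then have S: "S \<subseteq> {..<n}"
    using A by simp
  then have fin: "finite S"
    using finite_subset by blast
  define m where "m = card S"
  \<comment> \<open>This set is how \<open>submatrix\<close> expresses its dimensions and the bounds
    on its indices.\<close>
  have card: "card {i. i < n \<and> i \<in> S} = m"
    unfolding m_def using S by (intro arg_cong[where f = card]) auto
  \<comment> \<open>\<open>pick S\<close> is the increasing enumeration of \<open>S\<close> by which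
    \<open>submatrix\<close> renumbers rows and columns; it transports sums over \<open>S\<close> to
    sums over indices below \<open>m\<close>.\<close>
  have "inj_on (pick S) {..<m}"
    by (rule inj_onI) (metis lessThan_iff m_def nat_neq_iff pick_mono)
  moreover have "pick S ` {..<m} \<subseteq> S"
    using pick_in_set[of _ S] by (auto simp: m_def)
  ultimately have bij: "bij_betw (pick S) {..<m} S"
    by (simp add: bij_betw_def card_image card_subset_eq fin m_def)
  show "0 < Determinant.det (submatrix A S S)"
  proof (rule det_pos_if_weighted_form_pos)
    show "submatrix A S S \<in> carrier_mat m m"
      using A by (intro carrier_matI) (auto simp: dim_submatrix card)
    show "0 < d (pick S i)" if "i < m" for i
      using that d S pick_in_set[of i S] by (auto simp: m_def)
    fix v :: "nat \<Rightarrow> real" assume v: "\<exists>i<m. v i \<noteq> 0"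
    \<comment> \<open>The extension of \<open>v\<close> by zero, read through the inverse of the
      enumeration.\<close>
    define w where "w k = (if k \<in> S then v (inv_into {..<m} (pick S) k) else 0)" for k
    have w: "w (pick S i) = v i" if "i < m" for i
      using that bij by (auto simp: w_def bij_betw_def)
    have "\<exists>k<n. w k \<noteq> 0"
      using v w S pick_in_set[of _ S] by (metis lessThan_iff m_def subsetD)
    then have "0 < (\<Sum>i<n. \<Sum>j<n. w i * A $$ (i, j) * d j * w j)"
      by (rule form)
    also have "\<dots> = (\<Sum>i\<in>S. \<Sum>j\<in>S. w i * A $$ (i, j) * d j * w j)"
      using S by (intro sum.mono_neutral_cong_right) (auto simp: w_def intro!: sum.mono_neutral_right)
    also have "\<dots> = (\<Sum>i<m. \<Sum>j<m. w (pick S i) * A $$ (pick S i, pick S j)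
        * d (pick S j) * w (pick S j))"
      by (simp add: sum.reindex_bij_betw[OF bij, symmetric])
    also have "\<dots> = (\<Sum>i<m. \<Sum>j<m. v i * submatrix A S S $$ (i, j) * d (pick S j) * v j)"
      using A by (intro sum.cong refl) (simp add: w submatrix_index card)
    finally show "0 < (\<Sum>i<m. \<Sum>j<m. v i * submatrix A S S $$ (i, j) * d (pick S j) * v j)" .
  qed
qed

section \<open>Square-integrable functions\<close>

text \<open>Measurability is a separate conjunct because integrability of the square does not imply
  it: a non-measurable function with values 1 and -1 has a constant square.\<close>

definition sq_integrable :: "'a measure \<Rightarrow> ('a \<Rightarrow> real) \<Rightarrow> bool" where
  "sq_integrable M f \<longleftrightarrow> f \<in> borel_measurable M \<and> integrable M (\<lambda>x. (f x)\<^sup>2)"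

lemma sq_integrable_integrable_mult:
  assumes "sq_integrable M f" "sq_integrable M g"
  shows "integrable M (\<lambda>x. f x * g x)"
proof (rule Bochner_Integration.integrable_bound)
  show "integrable M (\<lambda>x. (f x)\<^sup>2 + (g x)\<^sup>2)"
    using assms by (auto simp: sq_integrable_def)
  show "(\<lambda>x. f x * g x) \<in> borel_measurable M"
    using assms by (auto simp: sq_integrable_def)
  have "\<bar>p * q\<bar> \<le> p\<^sup>2 + q\<^sup>2" for p q :: real
  proof -
    have "2 * \<bar>p * q\<bar> \<le> p\<^sup>2 + q\<^sup>2"
      using sum_squares_bound[of "\<bar>p\<bar>" "\<bar>q\<bar>"] by (simp add: abs_mult mult.assoc)
    then show ?thesis
      using abs_ge_zero[of "p * q"] by linarith
  qed
  then show "AE x in M. norm (f x * g x) \<le> norm ((f x)\<^sup>2 + (g x)\<^sup>2)"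
    by simp
qed

lemma sq_integrable_add:
  assumes "sq_integrable M f" "sq_integrable M g"
  shows "sq_integrable M (\<lambda>x. f x + g x)"
  using assms sq_integrable_integrable_mult[OF assms]
  by (auto simp: sq_integrable_def power2_sum mult.assoc)

lemma sq_integrable_cmult:
  "sq_integrable M f \<Longrightarrow> sq_integrable M (\<lambda>x. c * f x)"
  by (auto simp: sq_integrable_def power_mult_distrib)

lemma sq_integrable_diff:
  assumes "sq_integrable M f" "sq_integrable M g"
  shows "sq_integrable M (\<lambda>x. f x - g x)"
  using sq_integrable_add[OF assms(1) sq_integrable_cmult[OF assms(2), of "-1"]] by simp

lemma sq_integrable_sum:
  "(\<And>i. i \<in> I \<Longrightarrow> sq_integrable M (f i)) \<Longrightarrow> sq_integrable M (\<lambda>x. \<Sum>i\<in>I. f i x)"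
  by (induction I rule: infinite_finite_induct)
    (auto simp: sq_integrable_add, auto simp: sq_integrable_def)

lemma (in finite_measure) sq_integrable_const: "sq_integrable M (\<lambda>x. c)"
  by (simp add: sq_integrable_def)

lemma (in finite_measure) sq_integrable_integrable: "sq_integrable M f \<Longrightarrow> integrable M f"
  unfolding sq_integrable_def using square_integrable_imp_integrable by blast

lemmas sq_integrable_intros = sq_integrable_add sq_integrable_diff sq_integrable_cmult sq_integrable_sum

section \<open>Orthogonality of regression residuals and elimination of a variable\<close>

text \<open>This is the defining property of conditional expectation, tested against
  \<open>W\<close>. The choice \<open>W = 1\<close> makes residuals centred; taking a conditioning
  variable for \<open>W\<close> gives the remaining normal equations.\<close>

lemma (in prob_space) cond_exp_residual_orthogonal:
  assumes sub: "subalgebra M F"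
    and U: "sq_integrable M U" and L: "sq_integrable M L"
    and W: "sq_integrable M W" "W \<in> borel_measurable F"
    and ce: "AE \<omega> in M. real_cond_exp M F U \<omega> = L \<omega>"
  shows "(\<integral>\<omega>. (U \<omega> - L \<omega>) * W \<omega> \<partial>M) = 0"
proof -
  interpret finite_measure_subalgebra M F
    by unfold_locales (rule sub)
  note [measurable] = borel_measurable_cond_exp2
  have meas: "U \<in> borel_measurable M" "L \<in> borel_measurable M" "W \<in> borel_measurable M"
    using U L W by (auto simp: sq_integrable_def)
  note [measurable] = meas
  have "(\<integral>\<omega>. W \<omega> * U \<omega> \<partial>M) = (\<integral>\<omega>. W \<omega> * real_cond_exp M F U \<omega> \<partial>M)"
    using real_cond_exp_intg(2)[of W U] sq_integrable_integrable_mult[OF W(1) U] W(2) by simp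
  also have "\<dots> = (\<integral>\<omega>. W \<omega> * L \<omega> \<partial>M)"
    using ce by (intro integral_cong_AE) auto
  finally show ?thesis
    using sq_integrable_integrable_mult[OF W(1) U] sq_integrable_integrable_mult[OF W(1) L]
    by (simp add: left_diff_distrib mult.commute[of "W _"])
qed

text \<open>Taking \<open>E[\<cdot> | G]\<close> of both regressions turns them into a linear system for
  \<open>E[U | G]\<close> and \<open>E[V | G]\<close> with determinant \<open>1 - \<alpha> \<beta>\<close>.\<close>
lemma (in prob_space) cond_exp_eliminate:
  assumes sub: "subalgebra M F1" "subalgebra M F2" "subalgebra F1 G" "subalgebra F2 G"
    and int: "integrable M U" "integrable M V" "integrable M L1" "integrable M L2"
    and meas: "L1 \<in> borel_measurable G" "L2 \<in> borel_measurable G"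
    and U: "AE \<omega> in M. real_cond_exp M F1 U \<omega> = L1 \<omega> + \<alpha> * V \<omega>"
    and V: "AE \<omega> in M. real_cond_exp M F2 V \<omega> = L2 \<omega> + \<beta> * U \<omega>"
    and det: "1 - \<alpha> * \<beta> \<noteq> 0"
  shows "AE \<omega> in M. real_cond_exp M G U \<omega> = (L1 \<omega> + \<alpha> * L2 \<omega>) / (1 - \<alpha> * \<beta>)"
proof -
  have "subalgebra M G"
    using sub(1,3) by (auto simp: subalgebra_def)
  then interpret finite_measure_subalgebra M G
    by unfold_locales
  \<comment> \<open>One regression projected to \<open>G\<close>: the tower property handles the
    left side, and \<open>L\<close> passes through because it is \<open>G\<close>-measurable. It is
    used twice, with the roles of \<open>U\<close> and \<open>V\<close> exchanged.\<close>
  have step: "AE \<omega> in M. real_cond_exp M G f \<omega> = L \<omega> + c * real_cond_exp M G g \<omega>"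
    if F: "subalgebra M F" "subalgebra F G"
      and i: "integrable M f" "integrable M g" "integrable M L"
      and L: "L \<in> borel_measurable G"
      and f: "AE \<omega> in M. real_cond_exp M F f \<omega> = L \<omega> + c * g \<omega>"
    for F f g L c
  proof -
    note [measurable] = borel_measurable_cond_exp2 borel_measurable_integrable[OF i(2)]
      borel_measurable_integrable[OF i(3)]
    have 1: "AE \<omega> in M. real_cond_exp M G (real_cond_exp M F f) \<omega> = real_cond_exp M G f \<omega>"
      by (rule real_cond_exp_nested_subalg[OF F i(1)])
    have 2: "AE \<omega> in M. real_cond_exp M G (real_cond_exp M F f) \<omega>
        = real_cond_exp M G (\<lambda>\<omega>. L \<omega> + c * g \<omega>) \<omega>"
      by (rule real_cond_exp_cong[OF f]) auto
    have 3: "AE \<omega> in M. real_cond_exp M G (\<lambda>\<omega>. L \<omega> + c * g \<omega>) \<omega>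
        = real_cond_exp M G L \<omega> + real_cond_exp M G (\<lambda>\<omega>. c * g \<omega>) \<omega>"
      using i by (intro real_cond_exp_add) auto
    have 4: "AE \<omega> in M. real_cond_exp M G (\<lambda>\<omega>. c * g \<omega>) \<omega> = c * real_cond_exp M G g \<omega>"
      by (rule real_cond_exp_cmult[OF i(2)])
    have 5: "AE \<omega> in M. real_cond_exp M G L \<omega> = L \<omega>"
      by (rule real_cond_exp_F_meas[OF i(3) L])
    from 1 2 3 4 5 show ?thesis by eventually_elim simp
  qed
  have "AE \<omega> in M. real_cond_exp M G U \<omega> = L1 \<omega> + \<alpha> * real_cond_exp M G V \<omega>"
    by (rule step[OF sub(1,3) int(1,2,3) meas(1) U])
  moreover have "AE \<omega> in M. real_cond_exp M G V \<omega> = L2 \<omega> + \<beta> * real_cond_exp M G U \<omega>"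
    by (rule step[OF sub(2,4) int(2,1,4) meas(2) V])
  ultimately show ?thesis
  proof eventually_elim
    case (elim \<omega>)
    then have "(1 - \<alpha> * \<beta>) * real_cond_exp M G U \<omega> = L1 \<omega> + \<alpha> * L2 \<omega>"
      by (simp add: algebra_simps)
    then show ?case
      using det by (simp add: eq_divide_eq mult.commute)
  qed
qed

section \<open>Second-moment analysis of a linear regression system\<close>

text \<open>Only the normal equations are recorded, since positivity of the minors depends on first
  and second moments alone. The locale thus serves both forms of conditioning: on pairs of
  natural-number-valued variables and on real families.\<close>

locale regression_system = prob_space M for M :: "'a measure" +
  fixes I :: "nat set" and X :: "nat \<Rightarrow> 'a \<Rightarrow> real" and a :: "nat \<Rightarrow> nat \<Rightarrow> real"
  assumes finite_I: "finite I"
    and sq_X: "i \<in> I \<Longrightarrow> sq_integrable M (X i)"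
    and indep: "lin_indep_rvs M I X"
    and mean: "i \<in> I \<Longrightarrow> (\<integral>\<omega>. X i \<omega> - (a i i + (\<Sum>j\<in>I - {i}. a i j * X j \<omega>)) \<partial>M) = 0"
    and orth: "i \<in> I \<Longrightarrow> k \<in> I \<Longrightarrow> k \<noteq> i
      \<Longrightarrow> (\<integral>\<omega>. (X i \<omega> - (a i i + (\<Sum>j\<in>I - {i}. a i j * X j \<omega>))) * X k \<omega> \<partial>M) = 0"
begin

definition resid :: "nat \<Rightarrow> 'a \<Rightarrow> real" where
  "resid i \<omega> = X i \<omega> - (a i i + (\<Sum>j\<in>I - {i}. a i j * X j \<omega>))"

text \<open>The coefficient matrix indexed by \<open>I\<close> itself, without the shift built into
  \<open>coeff_matrix\<close>.\<close>

definition B :: "nat \<Rightarrow> nat \<Rightarrow> real" where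
  "B i j = (if i = j then 1 else - a i j)"

definition d :: "nat \<Rightarrow> real" where
  "d i = (\<integral>\<omega>. resid i \<omega> * X i \<omega> \<partial>M)"

lemma resid_eq:
  assumes "i \<in> I"
  shows "resid i \<omega> = (\<Sum>j\<in>I. B i j * X j \<omega>) - a i i"
proof -
  have "(\<Sum>j\<in>I - {i}. B i j * X j \<omega>) = - (\<Sum>j\<in>I - {i}. a i j * X j \<omega>)"
    unfolding sum_negf[symmetric] by (intro sum.cong) (auto simp: B_def)
  then show ?thesis
    using assms finite_I by (simp add: resid_def sum.remove[of I i] B_def)
qed

lemma sq_resid: "i \<in> I \<Longrightarrow> sq_integrable M (resid i)"
  unfolding resid_def[abs_def] by (intro sq_integrable_intros sq_integrable_const sq_X) auto

lemma integral_resid_X: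
  "i \<in> I \<Longrightarrow> k \<in> I \<Longrightarrow> (\<integral>\<omega>. resid i \<omega> * X k \<omega> \<partial>M) = (if k = i then d i else 0)"
  using orth[of i k] by (auto simp: resid_def d_def)

text \<open>Expand the first residual as a combination of the \<open>X j\<close> minus a constant.
  Against \<open>resid k\<close> only the term \<open>j = k\<close> survives, by orthogonality, and
  the constant vanishes because \<open>resid k\<close> is centred.\<close>

lemma integral_resid_resid:
  assumes "i \<in> I" "k \<in> I"
  shows "(\<integral>\<omega>. resid i \<omega> * resid k \<omega> \<partial>M) = B i k * d k"
proof -
  have [simp]: "integrable M (\<lambda>\<omega>. resid k \<omega> * X j \<omega>)" if "j \<in> I" for j
    using that assms by (intro sq_integrable_integrable_mult sq_resid sq_X)
  have [simp]: "integrable M (resid k)"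
    using assms sq_resid sq_integrable_integrable by blast
  have "(\<integral>\<omega>. resid i \<omega> * resid k \<omega> \<partial>M)
      = (\<integral>\<omega>. (\<Sum>j\<in>I. B i j * (resid k \<omega> * X j \<omega>)) - a i i * resid k \<omega> \<partial>M)"
    by (intro Bochner_Integration.integral_cong)
      (simp_all add: resid_eq[OF assms(1)] sum_distrib_left algebra_simps)
  also have "\<dots> = (\<Sum>j\<in>I. B i j * (\<integral>\<omega>. resid k \<omega> * X j \<omega> \<partial>M)) - a i i * (\<integral>\<omega>. resid k \<omega> \<partial>M)"
    by (simp add: Bochner_Integration.integral_diff Bochner_Integration.integral_sum)
  also have "(\<integral>\<omega>. resid k \<omega> \<partial>M) = 0"
    using mean[OF assms(2)] by (simp add: resid_def)
  also have "(\<Sum>j\<in>I. B i j * (\<integral>\<omega>. resid k \<omega> * X j \<omega> \<partial>M)) = (\<Sum>j\<in>I. if j = k then B i j * d k else 0)"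
    using assms by (intro sum.cong) (auto simp: integral_resid_X)
  also have "\<dots> = B i k * d k"
    using assms finite_I by simp
  finally show ?thesis by simp
qed

text \<open>Both sides are the second moment of \<open>resid i\<close> against
  \<open>resid k\<close>.\<close>

lemma B_symmetrizable: "i \<in> I \<Longrightarrow> k \<in> I \<Longrightarrow> B i k * d k = B k i * d i"
  using integral_resid_resid[of i k] integral_resid_resid[of k i] by (simp add: mult.commute)

text \<open>Since \<open>B i i = 1\<close>, \<open>d i\<close> is the second moment of
  \<open>resid i\<close>. If it vanished, the combination of the \<open>X j\<close> with
  coefficients \<open>B i j\<close> would be almost surely constant, although its coefficient at
  \<open>i\<close> is 1.\<close>

lemma d_pos:
  assumes i: "i \<in> I"
  shows "0 < d i"
proof -
  have d: "d i = (\<integral>\<omega>. (resid i \<omega>)\<^sup>2 \<partial>M)"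
    using integral_resid_resid[OF i i] by (simp add: B_def power2_eq_square)
  have int: "integrable M (\<lambda>\<omega>. (resid i \<omega>)\<^sup>2)"
    using sq_resid[OF i] by (simp add: sq_integrable_def)
  have "\<not> (AE \<omega> in M. (\<Sum>j\<in>I. B i j * X j \<omega>) = a i i)"
    using indep i unfolding lin_indep_rvs_def by (metis B_def zero_neq_one)
  then have "\<not> (AE \<omega> in M. (resid i \<omega>)\<^sup>2 = 0)"
    using resid_eq[OF i] by simp
  then have "d i \<noteq> 0"
    unfolding d using integral_nonneg_eq_0_iff_AE[OF int] by simp
  moreover have "0 \<le> d i"
    unfolding d by simp
  ultimately show ?thesis by simp
qed

text \<open>The form is the second moment of \<open>R\<close>, the combination of the residuals with
  coefficients \<open>v\<close>, so the point is that the residuals are linearly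
  independent.\<close>

lemma weighted_form_pos:
  assumes v: "\<exists>i\<in>I. v i \<noteq> 0"
  shows "0 < (\<Sum>i\<in>I. \<Sum>j\<in>I. v i * B i j * d j * v j)"
proof -
  define R where "R \<omega> = (\<Sum>i\<in>I. v i * resid i \<omega>)" for \<omega>
  have sqR: "sq_integrable M R"
    unfolding R_def[abs_def] by (intro sq_integrable_intros sq_resid)
  then have int: "integrable M (\<lambda>\<omega>. (R \<omega>)\<^sup>2)"
    by (simp add: sq_integrable_def)
  have [simp]: "integrable M (\<lambda>\<omega>. resid i \<omega> * resid j \<omega>)" if "i \<in> I" "j \<in> I" for i j
    using that by (intro sq_integrable_integrable_mult sq_resid)
  have "(\<integral>\<omega>. (R \<omega>)\<^sup>2 \<partial>M) = (\<integral>\<omega>. (\<Sum>i\<in>I. \<Sum>j\<in>I. v i * v j * (resid i \<omega> * resid j \<omega>)) \<partial>M)"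
    by (intro Bochner_Integration.integral_cong)
      (simp_all add: R_def power2_eq_square sum_product mult_ac)
  also have "\<dots> = (\<Sum>i\<in>I. \<Sum>j\<in>I. v i * v j * (\<integral>\<omega>. resid i \<omega> * resid j \<omega> \<partial>M))"
    by (simp add: Bochner_Integration.integral_sum)
  also have "\<dots> = (\<Sum>i\<in>I. \<Sum>j\<in>I. v i * B i j * d j * v j)"
    by (intro sum.cong refl) (simp add: integral_resid_resid mult_ac)
  finally have eq: "(\<integral>\<omega>. (R \<omega>)\<^sup>2 \<partial>M) = (\<Sum>i\<in>I. \<Sum>j\<in>I. v i * B i j * d j * v j)" .
  have "(\<integral>\<omega>. (R \<omega>)\<^sup>2 \<partial>M) \<noteq> 0"
  proof
    assume "(\<integral>\<omega>. (R \<omega>)\<^sup>2 \<partial>M) = 0"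
    then have R0: "AE \<omega> in M. R \<omega> = 0"
      using integral_nonneg_eq_0_iff_AE[OF int] by simp
    obtain k where k: "k \<in> I" "v k \<noteq> 0"
      using v by blast
    have [simp]: "integrable M (\<lambda>\<omega>. resid i \<omega> * X k \<omega>)" if "i \<in> I" for i
      using that k by (intro sq_integrable_integrable_mult sq_resid sq_X)
    \<comment> \<open>Pairing with \<open>X k\<close> isolates one coefficient: every residual
      except \<open>resid k\<close> is orthogonal to \<open>X k\<close>.\<close>
    have "0 = (\<integral>\<omega>. R \<omega> * X k \<omega> \<partial>M)"
      by (rule sym, rule integral_eq_zero_AE) (use R0 in auto)
    also have "\<dots> = (\<integral>\<omega>. (\<Sum>i\<in>I. v i * (resid i \<omega> * X k \<omega>)) \<partial>M)"
      by (intro Bochner_Integration.integral_cong) (simp_all add: R_def sum_distrib_right mult.assoc)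
    also have "\<dots> = (\<Sum>i\<in>I. v i * (\<integral>\<omega>. resid i \<omega> * X k \<omega> \<partial>M))"
      by (simp add: Bochner_Integration.integral_sum)
    also have "\<dots> = (\<Sum>i\<in>I. if i = k then v i * d i else 0)"
      using k by (intro sum.cong) (auto simp: integral_resid_X)
    also have "\<dots> = v k * d k"
      using k finite_I by simp
    finally show False
      using k d_pos[of k] by simp
  qed
  moreover have "0 \<le> (\<integral>\<omega>. (R \<omega>)\<^sup>2 \<partial>M)"
    by simp
  ultimately show ?thesis
    unfolding eq by linarith
qed

text \<open>The 2 by 2 minor is read off directly from one value of the weighted form; its
  nonvanishing is what elimination of a variable requires.\<close>

lemma pair_minor_pos:
  assumes ik: "i \<in> I" "k \<in> I" "i \<noteq> k"
  shows "0 < 1 - a i k * a k i"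
proof -
  \<comment> \<open>With entry 1 at \<open>k\<close> and \<open>t\<close> at \<open>i\<close>,
    symmetrizability turns the form into \<open>d i * t^2 - 2 * a k i * d i * t + d k\<close>. Its
    minimum is at \<open>t = a k i\<close>, with value
    \<open>(1 - a i k * a k i) * d k\<close>.\<close>
  define v where "v j = (if j = i then a k i else if j = k then 1 else 0)" for j
  have "0 < (\<Sum>p\<in>I. \<Sum>q\<in>I. v p * B p q * d q * v q)"
    using ik by (intro weighted_form_pos) (auto simp: v_def)
  also have "\<dots> = (\<Sum>p\<in>{i, k}. \<Sum>q\<in>{i, k}. v p * B p q * d q * v q)"
    using ik finite_I
    by (intro sum.mono_neutral_cong_right) (auto simp: v_def intro!: sum.mono_neutral_right)
  also have "\<dots> = a k i * (a k i * d i) - a k i * (a i k * d k) - a k i * (a k i * d i) + d k"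
    using ik by (simp add: v_def B_def algebra_simps)
  also have "a i k * d k = a k i * d i"
    using B_symmetrizable[of i k] ik by (simp add: B_def)
  also have "a k i * (a k i * d i) - a k i * (a k i * d i) - a k i * (a k i * d i) + d k
      = (1 - a i k * a k i) * d k"
    using B_symmetrizable[of i k] ik by (simp add: B_def algebra_simps)
  finally show ?thesis
    using d_pos[OF ik(2)] by (simp add: zero_less_mult_iff)
qed

lemma principal_minors_pos_coeff_matrix:
  assumes "I = {1..n}"
  shows "principal_minors_pos (coeff_matrix n a)" "0 < Determinant.det (coeff_matrix n a)"
proof -
  have carrier: "coeff_matrix n a \<in> carrier_mat n n"
    by (simp add: coeff_matrix_def)
  have d: "0 < d (Suc i)" if "i < n" for i
    using that assms by (intro d_pos) auto
  have form: "0 < (\<Sum>i<n. \<Sum>j<n. v i * coeff_matrix n a $$ (i, j) * d (Suc j) * v j)"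
    if v: "\<exists>i<n. v i \<noteq> 0" for v
  proof -
    have bij: "bij_betw Suc {..<n} I"
      unfolding assms by (rule bij_betw_byWitness[where f' = "\<lambda>i. i - 1"]) auto
    \<comment> \<open>Vectors indexed from 0 are moved to \<open>I\<close> by \<open>i - 1\<close>;
      the truncated subtraction is exact because \<open>I\<close> starts at 1.\<close>
    have "\<exists>i\<in>I. v (i - 1) \<noteq> 0"
      using v assms by (metis atLeastAtMost_iff diff_Suc_1 Suc_leI le_add1 plus_1_eq_Suc)
    then have "0 < (\<Sum>i\<in>I. \<Sum>j\<in>I. v (i - 1) * B i j * d j * v (j - 1))"
      by (rule weighted_form_pos)
    also have "\<dots> = (\<Sum>i<n. \<Sum>j<n. v i * coeff_matrix n a $$ (i, j) * d (Suc j) * v j)"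
      by (simp add: sum.reindex_bij_betw[OF bij, symmetric] coeff_matrix_def B_def)
    finally show ?thesis .
  qed
  show "principal_minors_pos (coeff_matrix n a)"
    by (rule principal_minors_pos_if_weighted_form_pos[OF carrier d form])
  show "0 < Determinant.det (coeff_matrix n a)"
    by (rule det_pos_if_weighted_form_pos[OF carrier d form])
qed

end


section \<open>Sigma-algebras generated by random elements and by finite families\<close>

lemma subalgebra_vimage_algebra:
  assumes "V \<in> measurable M N"
  shows "subalgebra M (vimage_algebra (space M) V N)"
  using sets_image_in_sets[OF refl assms] by (simp add: subalgebra_def)

lemma measurable_vimage_algebra_compose:
  assumes V: "V \<in> measurable M N" and g: "g \<in> measurable N K"
    and W: "\<And>\<omega>. \<omega> \<in> space M \<Longrightarrow> W \<omega> = g (V \<omega>)"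
  shows "W \<in> measurable (vimage_algebra (space M) V N) K"
proof -
  have "V \<in> measurable (vimage_algebra (space M) V N) N"
    using V by (intro measurable_vimage_algebra1) (auto dest: measurable_space)
  from measurable_compose[OF this g] show ?thesis
    using W by (subst measurable_cong[where g = "\<lambda>\<omega>. g (V \<omega>)"]) auto
qed

text \<open>A function of \<open>V\<close> generates a coarser sigma-algebra than \<open>V\<close>;
  this supplies the nesting for the tower property.\<close>

lemma subalgebra_vimage_algebra_compose:
  assumes "V \<in> measurable M N" "g \<in> measurable N K"
    "\<And>\<omega>. \<omega> \<in> space M \<Longrightarrow> W \<omega> = g (V \<omega>)"
  shows "subalgebra (vimage_algebra (space M) V N) (vimage_algebra (space M) W K)"
  using subalgebra_vimage_algebra[OF measurable_vimage_algebra_compose[OF assms]] by simp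

definition family_algebra :: "'a measure \<Rightarrow> (nat \<Rightarrow> 'a \<Rightarrow> real) \<Rightarrow> nat set \<Rightarrow> 'a measure" where
  "family_algebra M X J
     = vimage_algebra (space M) (\<lambda>\<omega>. \<lambda>j\<in>J. X j \<omega>) (Pi\<^sub>M J (\<lambda>_. borel))"

lemma cond_exp_family_eq: "cond_exp_family M X J f = real_cond_exp M (family_algebra M X J) f"
  by (simp add: cond_exp_family_def cond_exp_given_def family_algebra_def)

lemma measurable_family:
  assumes "\<And>j. j \<in> J \<Longrightarrow> X j \<in> borel_measurable M"
  shows "(\<lambda>\<omega>. \<lambda>j\<in>J. X j \<omega>) \<in> measurable M (Pi\<^sub>M J (\<lambda>_. borel))"
  using assms by (rule measurable_restrict)

lemma subalgebra_family_algebra: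
  assumes "\<And>j. j \<in> J \<Longrightarrow> X j \<in> borel_measurable M"
  shows "subalgebra M (family_algebra M X J)"
  unfolding family_algebra_def by (intro subalgebra_vimage_algebra measurable_family assms)

text \<open>The tuple over \<open>J\<close> is the restriction of the tuple over \<open>K\<close>,
  and restriction is measurable between the product spaces.\<close>

lemma subalgebra_family_algebra_mono:
  assumes "\<And>j. j \<in> K \<Longrightarrow> X j \<in> borel_measurable M" "J \<subseteq> K"
  shows "subalgebra (family_algebra M X K) (family_algebra M X J)"
  unfolding family_algebra_def
  using assms
  by (intro subalgebra_vimage_algebra_compose[where g = "\<lambda>x. restrict x J"] measurable_family
      measurable_restrict_subset)
    (auto simp: restrict_def fun_eq_iff)

lemma measurable_family_algebra:
  assumes "\<And>j. j \<in> J \<Longrightarrow> X j \<in> borel_measurable M" "k \<in> J"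
  shows "X k \<in> borel_measurable (family_algebra M X J)"
  unfolding family_algebra_def
  using assms
  by (intro measurable_vimage_algebra_compose[where g = "\<lambda>x. x k"] measurable_family
      measurable_component_singleton) auto

text \<open>Coefficients on \<open>J\<close> extend by zero to \<open>I\<close>.\<close>

lemma lin_indep_rvs_subset:
  assumes "lin_indep_rvs M I X" "finite I" "J \<subseteq> I"
  shows "lin_indep_rvs M J X"
  unfolding lin_indep_rvs_def
proof (intro allI impI)
  fix c :: "nat \<Rightarrow> real" assume c: "\<exists>i\<in>J. c i \<noteq> 0"
  define c' where "c' i = (if i \<in> J then c i else 0)" for i
  have "(\<Sum>i\<in>J. c i * X i \<omega>) = (\<Sum>i\<in>I. c' i * X i \<omega>)" for \<omega>
    using assms(2,3) by (intro sum.mono_neutral_cong_left) (auto simp: c'_def)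
  moreover have "\<exists>i\<in>I. c' i \<noteq> 0"
    using c assms(3) by (auto simp: c'_def)
  ultimately show "\<not> (\<exists>d. AE \<omega> in M. (\<Sum>i\<in>J. c i * X i \<omega>) = d)"
    using assms(1) unfolding lin_indep_rvs_def by simp
qed

text \<open>Residual orthogonality is applied with the constant 1 and with each \<open>X k\<close>,
  \<open>k \<noteq> i\<close>, which is measurable for the sigma-algebra that \<open>X i\<close> is
  conditioned on.\<close>

lemma (in prob_space) regression_system_family:
  assumes fin: "finite I" and sq: "\<And>i. i \<in> I \<Longrightarrow> sq_integrable M (X i)"
    and indep: "lin_indep_rvs M I X"
    and ce: "\<And>i. i \<in> I \<Longrightarrow> AE \<omega> in M. cond_exp_family M X (I - {i}) (X i) \<omega>
      = a i i + (\<Sum>j\<in>I - {i}. a i j * X j \<omega>)"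
  shows "regression_system M I X a"
proof unfold_locales
  have meas: "X j \<in> borel_measurable M" if "j \<in> I" for j
    using sq[OF that] by (simp add: sq_integrable_def)
  have residual: "(\<integral>\<omega>. (X i \<omega> - (a i i + (\<Sum>j\<in>I - {i}. a i j * X j \<omega>))) * W \<omega> \<partial>M) = 0"
    if "i \<in> I" "sq_integrable M W" "W \<in> borel_measurable (family_algebra M X (I - {i}))" for i W
    using that meas sq
    by (intro cond_exp_residual_orthogonal[OF subalgebra_family_algebra[of "I - {i}" X]]
        ce[unfolded cond_exp_family_eq] sq_integrable_intros sq_integrable_const) auto
  show "(\<integral>\<omega>. X i \<omega> - (a i i + (\<Sum>j\<in>I - {i}. a i j * X j \<omega>)) \<partial>M) = 0" if "i \<in> I" for i
    using residual[OF that, of "\<lambda>_. 1"] by (simp add: sq_integrable_const)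
  show "(\<integral>\<omega>. (X i \<omega> - (a i i + (\<Sum>j\<in>I - {i}. a i j * X j \<omega>))) * X k \<omega> \<partial>M) = 0"
    if "i \<in> I" "k \<in> I" "k \<noteq> i" for i k
    using that meas by (intro residual sq measurable_family_algebra) auto
qed (use assms in auto)

section \<open>Passing to subvectors by removing variables one at a time\<close>

text \<open>The regressions of \<open>X i\<close> and \<open>X k\<close> on all other variables are
  projected to the variables common to both, and \<open>X k\<close> is eliminated. The determinant
  of this system is positive by \<open>pair_minor_pos\<close> for the regression system on
  \<open>T\<close>.\<close>

lemma (in prob_space) cond_exp_family_linear_remove:
  assumes fin: "finite T" and sq: "\<And>i. i \<in> T \<Longrightarrow> sq_integrable M (X i)"
    and indep: "lin_indep_rvs M T X"
    and ce: "\<And>i. i \<in> T \<Longrightarrow> \<exists>b c. AE \<omega> in M. cond_exp_family M X (T - {i}) (X i) \<omega>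
      = b + (\<Sum>j\<in>T - {i}. c j * X j \<omega>)"
    and ik: "i \<in> T" "k \<in> T" "i \<noteq> k"
  shows "\<exists>b c. AE \<omega> in M. cond_exp_family M X (T - {k} - {i}) (X i) \<omega>
      = b + (\<Sum>j\<in>T - {k} - {i}. c j * X j \<omega>)"
proof -
  define T' where "T' = T - {k} - {i}"
  have T': "T - {i} = insert k T'" "T - {k} = insert i T'" "finite T'" "i \<notin> T'" "k \<notin> T'"
    "T' \<subseteq> T"
    using ik fin by (auto simp: T'_def)
  obtain b c where bc: "\<And>i. i \<in> T \<Longrightarrow> AE \<omega> in M. cond_exp_family M X (T - {i}) (X i) \<omega>
      = b i + (\<Sum>j\<in>T - {i}. c i j * X j \<omega>)"
    using ce by metis
  \<comment> \<open>Constant terms go on the diagonal, as \<open>regression_system\<close>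
    expects.\<close>
  define a where "a i j = (if i = j then b i else c i j)" for i j
  have a: "AE \<omega> in M. cond_exp_family M X (T - {i}) (X i) \<omega>
      = a i i + (\<Sum>j\<in>T - {i}. a i j * X j \<omega>)" if "i \<in> T" for i
  proof -
    have "(\<Sum>j\<in>T - {i}. a i j * X j \<omega>) = (\<Sum>j\<in>T - {i}. c i j * X j \<omega>)" for \<omega>
      by (intro sum.cong) (auto simp: a_def)
    then show ?thesis
      using bc[OF that] by (simp add: a_def)
  qed
  interpret regression_system M T X a
    by (rule regression_system_family[OF fin sq indep a])
  have meas: "X j \<in> borel_measurable M" if "j \<in> T" for j
    using sq[OF that] by (simp add: sq_integrable_def)
  have det: "1 - a i k * a k i \<noteq> 0"
    using pair_minor_pos[OF ik] by simp
  \<comment> \<open>The part of the regression of \<open>X p\<close> that involves only the common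
    variables \<open>T'\<close>, hence is measurable for the target sigma-algebra.\<close>
  define L where "L p \<omega> = a p p + (\<Sum>j\<in>T'. a p j * X j \<omega>)" for p \<omega>
  have intL: "integrable M (L p)" for p
    unfolding L_def[abs_def] using T'(6)
    by (intro sq_integrable_integrable sq_integrable_intros sq_integrable_const sq) auto
  have measL: "L p \<in> borel_measurable (family_algebra M X T')" for p
    unfolding L_def[abs_def] using meas T'
    by (intro borel_measurable_add borel_measurable_sum borel_measurable_times
        borel_measurable_const measurable_family_algebra) auto
  have "AE \<omega> in M. real_cond_exp M (family_algebra M X T') (X i) \<omega>
      = (L i \<omega> + a i k * L k \<omega>) / (1 - a i k * a k i)"
  proof (rule cond_exp_eliminate[where U = "X i" and V = "X k" and ?L1.0 = "L i" and ?L2.0 = "L k"])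
    show "subalgebra M (family_algebra M X (T - {i}))" "subalgebra M (family_algebra M X (T - {k}))"
      using meas by (auto intro: subalgebra_family_algebra)
    show "subalgebra (family_algebra M X (T - {i})) (family_algebra M X T')"
      "subalgebra (family_algebra M X (T - {k})) (family_algebra M X T')"
      using meas by (auto intro!: subalgebra_family_algebra_mono simp: T'_def)
    show "AE \<omega> in M. real_cond_exp M (family_algebra M X (T - {i})) (X i) \<omega> = L i \<omega> + a i k * X k \<omega>"
      using a[OF ik(1)] T' by (simp add: cond_exp_family_eq L_def algebra_simps)
    show "AE \<omega> in M. real_cond_exp M (family_algebra M X (T - {k})) (X k) \<omega> = L k \<omega> + a k i * X i \<omega>"
      using a[OF ik(2)] T' by (simp add: cond_exp_family_eq L_def algebra_simps)
  qed (use ik sq[THEN sq_integrable_integrable] intL measL det in auto)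
  moreover have "(L i \<omega> + a i k * L k \<omega>) / (1 - a i k * a k i)
      = (a i i + a i k * a k k) / (1 - a i k * a k i)
        + (\<Sum>j\<in>T'. (a i j + a i k * a k j) / (1 - a i k * a k i) * X j \<omega>)" for \<omega>
    by (simp add: L_def sum.distrib sum_distrib_left sum_divide_distrib[symmetric]
        add_divide_distrib algebra_simps)
  ultimately have "AE \<omega> in M. real_cond_exp M (family_algebra M X T') (X i) \<omega>
      = (a i i + a i k * a k k) / (1 - a i k * a k i)
        + (\<Sum>j\<in>T'. (a i j + a i k * a k j) / (1 - a i k * a k i) * X j \<omega>)"
    by (simp only:)
  then show ?thesis
    unfolding T'_def[symmetric] cond_exp_family_eq
    by (intro exI[of _ "(a i i + a i k * a k k) / (1 - a i k * a k i)"]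
        exI[of _ "\<lambda>j. (a i j + a i k * a k j) / (1 - a i k * a k i)"])
qed

lemma (in prob_space) cond_exp_family_linear_subset:
  assumes fin: "finite I" and sq: "\<And>i. i \<in> I \<Longrightarrow> sq_integrable M (X i)"
    and indep: "lin_indep_rvs M I X"
    and ce: "\<And>i. i \<in> I \<Longrightarrow> \<exists>b c. AE \<omega> in M. cond_exp_family M X (I - {i}) (X i) \<omega>
      = b + (\<Sum>j\<in>I - {i}. c j * X j \<omega>)"
    and S: "S \<subseteq> I" and i: "i \<in> S"
  shows "\<exists>b c. AE \<omega> in M. cond_exp_family M X (S - {i}) (X i) \<omega>
      = b + (\<Sum>j\<in>S - {i}. c j * X j \<omega>)"
proof -
  \<comment> \<open>Induction on the set of removed variables. The claim covers all remaining
    \<open>i\<close> at once, because each removal uses the regressions of every remaining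
    variable.\<close>
  have "\<forall>i\<in>I - D. \<exists>b c. AE \<omega> in M. cond_exp_family M X (I - D - {i}) (X i) \<omega>
      = b + (\<Sum>j\<in>I - D - {i}. c j * X j \<omega>)" if "finite D" "D \<subseteq> I" for D
    using that
  proof (induction D rule: finite_induct)
    case empty
    then show ?case
      using ce by simp
  next
    case (insert k D)
    have eq: "I - insert k D = I - D - {k}"
      by blast
    show ?case
      unfolding eq
    proof
      fix i assume "i \<in> I - D - {k}"
      then show "\<exists>b c. AE \<omega> in M. cond_exp_family M X (I - D - {k} - {i}) (X i) \<omega>
          = b + (\<Sum>j\<in>I - D - {k} - {i}. c j * X j \<omega>)"
        using insert fin sq lin_indep_rvs_subset[OF indep fin]
        by (intro cond_exp_family_linear_remove) auto
    qed
  qed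
  from this[of "I - S"] show ?thesis
    using fin S i by (simp add: double_diff)
qed

section \<open>Conditioning on pairs of discrete variables\<close>

text \<open>Both pairs generate the same sigma-algebra, so even the chosen versions coincide, not
  only almost surely.\<close>

lemma cond_exp_given_swap:
  "cond_exp_given M (\<lambda>\<omega>. (V \<omega>, W \<omega>)) (count_space UNIV) f
    = cond_exp_given M (\<lambda>\<omega>. (W \<omega>, V \<omega>)) (count_space UNIV) f"
proof -
  have sub: "{(\<lambda>\<omega>. (V \<omega>, W \<omega>)) -` A \<inter> space M |A. A \<in> UNIV}
      \<subseteq> {(\<lambda>\<omega>. (W \<omega>, V \<omega>)) -` A \<inter> space M |A. A \<in> UNIV}" for V :: "'a \<Rightarrow> 'x" and W :: "'a \<Rightarrow> 'y"
  proof safe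
    fix A :: "('x \<times> 'y) set"
    show "\<exists>B. (\<lambda>\<omega>. (V \<omega>, W \<omega>)) -` A \<inter> space M = (\<lambda>\<omega>. (W \<omega>, V \<omega>)) -` B \<inter> space M \<and> B \<in> UNIV"
      by (rule exI[of _ "prod.swap -` A"]) auto
  qed
  show ?thesis
    unfolding cond_exp_given_def vimage_algebra_def
    using sub[of V W] sub[of W V] by (simp add: subset_antisym)
qed

text \<open>Countability makes the product of the two discrete sigma-algebras the full power set of
  the pairs.\<close>

lemma measurable_nat_pair:
  fixes V W :: "'a \<Rightarrow> nat"
  assumes "V \<in> measurable M (count_space UNIV)" "W \<in> measurable M (count_space UNIV)"
  shows "(\<lambda>\<omega>. (V \<omega>, W \<omega>)) \<in> measurable M (count_space UNIV)"
  using measurable_Pair[OF assms] by (simp add: pair_measure_countable)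

lemma measurable_pair_components:
  fixes V W :: "'a \<Rightarrow> nat"
  assumes "V \<in> measurable M (count_space UNIV)" "W \<in> measurable M (count_space UNIV)"
  shows "(\<lambda>\<omega>. real (V \<omega>)) \<in> borel_measurable
      (vimage_algebra (space M) (\<lambda>\<omega>. (V \<omega>, W \<omega>)) (count_space UNIV))"
    and "(\<lambda>\<omega>. real (W \<omega>)) \<in> borel_measurable
      (vimage_algebra (space M) (\<lambda>\<omega>. (V \<omega>, W \<omega>)) (count_space UNIV))"
  by (rule measurable_vimage_algebra_compose[OF measurable_nat_pair[OF assms], of "\<lambda>x. real (fst x)"]; simp)
    (rule measurable_vimage_algebra_compose[OF measurable_nat_pair[OF assms], of "\<lambda>x. real (snd x)"]; simp)

lemma (in prob_space) cond_exp_pair_residual_orthogonal: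
  fixes U V W :: "'a \<Rightarrow> nat"
  assumes meas: "V \<in> measurable M (count_space UNIV)" "W \<in> measurable M (count_space UNIV)"
    and sq: "sq_integrable M (\<lambda>\<omega>. real (U \<omega>))" "sq_integrable M (\<lambda>\<omega>. real (V \<omega>))"
      "sq_integrable M (\<lambda>\<omega>. real (W \<omega>))"
    and ce: "AE \<omega> in M. cond_exp_given M (\<lambda>\<omega>. (V \<omega>, W \<omega>)) (count_space UNIV) (\<lambda>\<omega>. real (U \<omega>)) \<omega>
      = p + q * real (V \<omega>) + r * real (W \<omega>)"
  shows "(\<integral>\<omega>. real (U \<omega>) - (p + q * real (V \<omega>) + r * real (W \<omega>)) \<partial>M) = 0"
    and "(\<integral>\<omega>. (real (U \<omega>) - (p + q * real (V \<omega>) + r * real (W \<omega>))) * real (V \<omega>) \<partial>M) = 0"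
    and "(\<integral>\<omega>. (real (U \<omega>) - (p + q * real (V \<omega>) + r * real (W \<omega>))) * real (W \<omega>) \<partial>M) = 0"
proof -
  note orth = cond_exp_residual_orthogonal[OF subalgebra_vimage_algebra[OF measurable_nat_pair[OF meas]]
      sq(1) _ _ _ ce[unfolded cond_exp_given_def]]
  have L: "sq_integrable M (\<lambda>\<omega>. p + q * real (V \<omega>) + r * real (W \<omega>))"
    by (intro sq_integrable_intros sq_integrable_const sq)
  show "(\<integral>\<omega>. real (U \<omega>) - (p + q * real (V \<omega>) + r * real (W \<omega>)) \<partial>M) = 0"
    using orth[OF L, of "\<lambda>_. 1"] by (simp add: sq_integrable_const)
  show "(\<integral>\<omega>. (real (U \<omega>) - (p + q * real (V \<omega>) + r * real (W \<omega>))) * real (V \<omega>) \<partial>M) = 0"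
    by (rule orth[OF L sq(2) measurable_pair_components(1)[OF meas]])
  show "(\<integral>\<omega>. (real (U \<omega>) - (p + q * real (V \<omega>) + r * real (W \<omega>))) * real (W \<omega>) \<partial>M) = 0"
    by (rule orth[OF L sq(3) measurable_pair_components(2)[OF meas]])
qed

text \<open>\<open>V\<close> is eliminated between the regressions of \<open>U\<close> and
  \<open>V\<close>, both projected to the sigma-algebra of \<open>W\<close>. The retained variable
  stands second in both pairs, so \<open>snd\<close> exhibits it as a function of each.\<close>

lemma (in prob_space) cond_exp_pair_eliminate:
  fixes U V W :: "'a \<Rightarrow> nat"
  assumes meas: "U \<in> measurable M (count_space UNIV)" "V \<in> measurable M (count_space UNIV)"
      "W \<in> measurable M (count_space UNIV)"
    and int: "integrable M (\<lambda>\<omega>. real (U \<omega>))" "integrable M (\<lambda>\<omega>. real (V \<omega>))"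
      "integrable M (\<lambda>\<omega>. real (W \<omega>))"
    and U: "AE \<omega> in M. cond_exp_given M (\<lambda>\<omega>. (V \<omega>, W \<omega>)) (count_space UNIV) (\<lambda>\<omega>. real (U \<omega>)) \<omega>
      = p + q * real (V \<omega>) + r * real (W \<omega>)"
    and V: "AE \<omega> in M. cond_exp_given M (\<lambda>\<omega>. (U \<omega>, W \<omega>)) (count_space UNIV) (\<lambda>\<omega>. real (V \<omega>)) \<omega>
      = p' + q' * real (U \<omega>) + r' * real (W \<omega>)"
    and det: "1 - q * q' > 0"
  shows "\<exists>b c. AE \<omega> in M.
    cond_exp_given M W (count_space UNIV) (\<lambda>\<omega>. real (U \<omega>)) \<omega> = b + c * real (W \<omega>)"
proof -
  have W: "(\<lambda>\<omega>. real (W \<omega>)) \<in> borel_measurable (vimage_algebra (space M) W (count_space UNIV))"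
    by (rule measurable_vimage_algebra_compose[OF meas(3), of real]) auto
  have "AE \<omega> in M. cond_exp_given M W (count_space UNIV) (\<lambda>\<omega>. real (U \<omega>)) \<omega>
      = ((p + r * real (W \<omega>)) + q * (p' + r' * real (W \<omega>))) / (1 - q * q')"
    unfolding cond_exp_given_def
  proof (rule cond_exp_eliminate[where V = "\<lambda>\<omega>. real (V \<omega>)"])
    show "subalgebra M (vimage_algebra (space M) (\<lambda>\<omega>. (V \<omega>, W \<omega>)) (count_space UNIV))"
      "subalgebra M (vimage_algebra (space M) (\<lambda>\<omega>. (U \<omega>, W \<omega>)) (count_space UNIV))"
      by (intro subalgebra_vimage_algebra measurable_nat_pair meas)+
    show "subalgebra (vimage_algebra (space M) (\<lambda>\<omega>. (V \<omega>, W \<omega>)) (count_space UNIV))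
        (vimage_algebra (space M) W (count_space UNIV))"
      "subalgebra (vimage_algebra (space M) (\<lambda>\<omega>. (U \<omega>, W \<omega>)) (count_space UNIV))
        (vimage_algebra (space M) W (count_space UNIV))"
      by (rule subalgebra_vimage_algebra_compose[where g = snd]; simp add: measurable_nat_pair meas)+
    show "AE \<omega> in M. real_cond_exp M (vimage_algebra (space M) (\<lambda>\<omega>. (V \<omega>, W \<omega>)) (count_space UNIV))
        (\<lambda>\<omega>. real (U \<omega>)) \<omega> = p + r * real (W \<omega>) + q * real (V \<omega>)"
      using U by (simp add: cond_exp_given_def algebra_simps)
    show "AE \<omega> in M. real_cond_exp M (vimage_algebra (space M) (\<lambda>\<omega>. (U \<omega>, W \<omega>)) (count_space UNIV))
        (\<lambda>\<omega>. real (V \<omega>)) \<omega> = p' + r' * real (W \<omega>) + q' * real (U \<omega>)"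
      using V by (simp add: cond_exp_given_def algebra_simps)
  qed (use int W det in auto)
  moreover have "((p + r * real (W \<omega>)) + q * (p' + r' * real (W \<omega>))) / (1 - q * q')
      = (p + q * p') / (1 - q * q') + (r + q * r') / (1 - q * q') * real (W \<omega>)" for \<omega>
    by (simp add: add_divide_distrib algebra_simps)
  ultimately have "AE \<omega> in M. cond_exp_given M W (count_space UNIV) (\<lambda>\<omega>. real (U \<omega>)) \<omega>
      = (p + q * p') / (1 - q * q') + (r + q * r') / (1 - q * q') * real (W \<omega>)"
    by (simp only:)
  then show ?thesis
    by blast
qed

section \<open>Assembly of the three-variable and the n-variable statements\<close>

theorem theorem9:
  fixes M :: "'a measure"
  assumes "prob_space M"
  shows
    "(\<forall>(X :: 'a \<Rightarrow> nat) (Y :: 'a \<Rightarrow> nat) (Z :: 'a \<Rightarrow> nat) (a :: nat \<Rightarrow> nat \<Rightarrow> real).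
        X \<in> measurable M (count_space UNIV) \<and>
        Y \<in> measurable M (count_space UNIV) \<and>
        Z \<in> measurable M (count_space UNIV) \<and>
        integrable M (\<lambda>\<omega>. (real (X \<omega>))\<^sup>2) \<and>
        integrable M (\<lambda>\<omega>. (real (Y \<omega>))\<^sup>2) \<and>
        integrable M (\<lambda>\<omega>. (real (Z \<omega>))\<^sup>2) \<and>
        (\<forall>c1 c2 c3. (c1, c2, c3) \<noteq> (0, 0, 0) \<longrightarrow>
           \<not> (\<exists>d. AE \<omega> in M. c1 * real (X \<omega>) + c2 * real (Y \<omega>) + c3 * real (Z \<omega>) = d)) \<and>
        (\<forall>i\<in>{1, 2, 3}. \<forall>j\<in>{1, 2, 3}. 0 \<le> a i j) \<and>
        (AE \<omega> in M. cond_exp_given M (\<lambda>\<omega>. (Y \<omega>, Z \<omega>)) (count_space UNIV) (\<lambda>\<omega>. real (X \<omega>)) \<omega>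
           = a 1 1 + a 1 2 * real (Y \<omega>) + a 1 3 * real (Z \<omega>)) \<and>
        (AE \<omega> in M. cond_exp_given M (\<lambda>\<omega>. (X \<omega>, Z \<omega>)) (count_space UNIV) (\<lambda>\<omega>. real (Y \<omega>)) \<omega>
           = a 2 2 + a 2 1 * real (X \<omega>) + a 2 3 * real (Z \<omega>)) \<and>
        (AE \<omega> in M. cond_exp_given M (\<lambda>\<omega>. (X \<omega>, Y \<omega>)) (count_space UNIV) (\<lambda>\<omega>. real (Z \<omega>)) \<omega>
           = a 3 3 + a 3 1 * real (X \<omega>) + a 3 2 * real (Y \<omega>))
      \<longrightarrow>
        (\<forall>(U, V)\<in>{(X, Y), (X, Z), (Y, X), (Y, Z), (Z, X), (Z, Y)}. \<exists>b c. AE \<omega> in M.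
           cond_exp_given M V (count_space UNIV) (\<lambda>\<omega>. real (U \<omega>)) \<omega> = b + c * real (V \<omega>)) \<and>
        1 - a 1 2 * a 2 1 > 0 \<and> 1 - a 2 3 * a 3 2 > 0 \<and> 1 - a 1 3 * a 3 1 > 0 \<and>
        0 < Determinant.det (mat_of_rows_list 3
              [[1, - a 1 2, - a 1 3],
               [- a 2 1, 1, - a 2 3],
               [- a 3 1, - a 3 2, 1]]) \<and>
        principal_minors_pos (mat_of_rows_list 3
              [[1, - a 1 2, - a 1 3],
               [- a 2 1, 1, - a 2 3],
               [- a 3 1, - a 3 2, 1]]))
     \<and>
     (\<forall>(n :: nat) (X :: nat \<Rightarrow> 'a \<Rightarrow> real) (a :: nat \<Rightarrow> nat \<Rightarrow> real).
        n \<ge> 3 \<and>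
        (\<forall>i\<in>{1..n}. X i \<in> borel_measurable M \<and> integrable M (\<lambda>\<omega>. (X i \<omega>)\<^sup>2)) \<and>
        lin_indep_rvs M {1..n} X \<and>
        (\<forall>i\<in>{1..n}. AE \<omega> in M. cond_exp_family M X ({1..n} - {i}) (X i) \<omega>
           = a i i + (\<Sum>j\<in>{1..n} - {i}. a i j * X j \<omega>))
      \<longrightarrow>
        principal_minors_pos (coeff_matrix n a) \<and>
        (\<forall>S \<subseteq> {1..n}. \<forall>i\<in>S. \<exists>b c. AE \<omega> in M. cond_exp_family M X (S - {i}) (X i) \<omega>
           = b + (\<Sum>j\<in>S - {i}. c j * X j \<omega>)))"
proof ((rule conjI; intro allI impI), goal_cases)
  case (1 X Y Z a)
  interpret prob_space M
    by fact
  have meas: "X \<in> measurable M (count_space UNIV)" "Y \<in> measurable M (count_space UNIV)"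
      "Z \<in> measurable M (count_space UNIV)"
    and sqi: "integrable M (\<lambda>\<omega>. (real (X \<omega>))\<^sup>2)" "integrable M (\<lambda>\<omega>. (real (Y \<omega>))\<^sup>2)"
      "integrable M (\<lambda>\<omega>. (real (Z \<omega>))\<^sup>2)"
    and indep: "\<And>c1 c2 c3 d. (c1, c2, c3) \<noteq> (0, 0, 0) \<Longrightarrow>
      \<not> (AE \<omega> in M. c1 * real (X \<omega>) + c2 * real (Y \<omega>) + c3 * real (Z \<omega>) = d)"
    and ceX: "AE \<omega> in M. cond_exp_given M (\<lambda>\<omega>. (Y \<omega>, Z \<omega>)) (count_space UNIV) (\<lambda>\<omega>. real (X \<omega>)) \<omega>
      = a 1 1 + a 1 2 * real (Y \<omega>) + a 1 3 * real (Z \<omega>)"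
    and ceY: "AE \<omega> in M. cond_exp_given M (\<lambda>\<omega>. (X \<omega>, Z \<omega>)) (count_space UNIV) (\<lambda>\<omega>. real (Y \<omega>)) \<omega>
      = a 2 2 + a 2 1 * real (X \<omega>) + a 2 3 * real (Z \<omega>)"
    and ceZ: "AE \<omega> in M. cond_exp_given M (\<lambda>\<omega>. (X \<omega>, Y \<omega>)) (count_space UNIV) (\<lambda>\<omega>. real (Z \<omega>)) \<omega>
      = a 3 3 + a 3 1 * real (X \<omega>) + a 3 2 * real (Y \<omega>)"
    using 1 by blast+
  have sq: "sq_integrable M (\<lambda>\<omega>. real (X \<omega>))" "sq_integrable M (\<lambda>\<omega>. real (Y \<omega>))"
      "sq_integrable M (\<lambda>\<omega>. real (Z \<omega>))"
    using meas sqi by (auto simp: sq_integrable_def)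
  note int = sq[THEN sq_integrable_integrable]
  \<comment> \<open>Each regression is restated with its conditioning pair reversed, so that either
    variable can be the retained second component.\<close>
  have ceX': "AE \<omega> in M. cond_exp_given M (\<lambda>\<omega>. (Z \<omega>, Y \<omega>)) (count_space UNIV) (\<lambda>\<omega>. real (X \<omega>)) \<omega>
      = a 1 1 + a 1 3 * real (Z \<omega>) + a 1 2 * real (Y \<omega>)"
    using ceX by (simp add: cond_exp_given_swap[of M Y Z] add_ac)
  have ceY': "AE \<omega> in M. cond_exp_given M (\<lambda>\<omega>. (Z \<omega>, X \<omega>)) (count_space UNIV) (\<lambda>\<omega>. real (Y \<omega>)) \<omega>
      = a 2 2 + a 2 3 * real (Z \<omega>) + a 2 1 * real (X \<omega>)"
    using ceY by (simp add: cond_exp_given_swap[of M X Z] add_ac)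
  have ceZ': "AE \<omega> in M. cond_exp_given M (\<lambda>\<omega>. (Y \<omega>, X \<omega>)) (count_space UNIV) (\<lambda>\<omega>. real (Z \<omega>)) \<omega>
      = a 3 3 + a 3 2 * real (Y \<omega>) + a 3 1 * real (X \<omega>)"
    using ceZ by (simp add: cond_exp_given_swap[of M X Y] add_ac)
  \<comment> \<open>The triple as a family indexed by 1, 2, 3; every index other than 1 and 2 gives
    \<open>Z\<close>.\<close>
  define T :: "nat \<Rightarrow> 'a \<Rightarrow> real" where
    "T i \<omega> = real (if i = 1 then X \<omega> else if i = 2 then Y \<omega> else Z \<omega>)" for i \<omega>
  have T [simp]: "T (Suc 0) = (\<lambda>\<omega>. real (X \<omega>))" "T 2 = (\<lambda>\<omega>. real (Y \<omega>))" "T 3 = (\<lambda>\<omega>. real (Z \<omega>))"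
    by (auto simp: T_def fun_eq_iff)
  have I: "{1..3} = {Suc 0, 2, 3 :: nat}" "{Suc 0..3} = {Suc 0, 2, 3 :: nat}"
    by auto
  have I': "{Suc 0, 2, 3} - {Suc 0} = {2, 3 :: nat}" "{Suc 0, 2, 3} - {2} = {Suc 0, 3 :: nat}"
      "{Suc 0, 2, 3} - {3} = {Suc 0, 2 :: nat}"
    by auto
  have resid: "\<And>\<omega>. T (Suc 0) \<omega> - (a (Suc 0) (Suc 0) + (\<Sum>j\<in>{1..3} - {Suc 0}. a (Suc 0) j * T j \<omega>))
        = real (X \<omega>) - (a 1 1 + a 1 2 * real (Y \<omega>) + a 1 3 * real (Z \<omega>))"
    "\<And>\<omega>. T 2 \<omega> - (a 2 2 + (\<Sum>j\<in>{1..3} - {2}. a 2 j * T j \<omega>))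
        = real (Y \<omega>) - (a 2 2 + a 2 1 * real (X \<omega>) + a 2 3 * real (Z \<omega>))"
    "\<And>\<omega>. T 3 \<omega> - (a 3 3 + (\<Sum>j\<in>{1..3} - {3}. a 3 j * T j \<omega>))
        = real (Z \<omega>) - (a 3 3 + a 3 1 * real (X \<omega>) + a 3 2 * real (Y \<omega>))"
    by (simp_all add: I I')
  \<comment> \<open>The normal equations come from the regressions on pairs, three for each of the
    three variables, rather than from conditioning on a family.\<close>
  interpret regression_system M "{1..3}" T a
  proof unfold_locales
    show "lin_indep_rvs M {1..3} T"
      unfolding lin_indep_rvs_def
    proof (intro allI impI notI)
      fix c assume "\<exists>i\<in>{1..3}. c i \<noteq> 0" "\<exists>d. AE \<omega> in M. (\<Sum>i\<in>{1..3}. c i * T i \<omega>) = d"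
      then show False
        using indep[of "c 1" "c 2" "c 3"] by (auto simp: I add.assoc)
    qed
  next
    fix i :: nat assume "i \<in> {1..3}"
    then consider "i = Suc 0" | "i = 2" | "i = 3"
      by (auto simp: I)
    note i = this
    show "sq_integrable M (T i)"
      using i by cases (simp_all add: sq)
    note orth = cond_exp_pair_residual_orthogonal[OF meas(2,3) sq ceX]
      cond_exp_pair_residual_orthogonal[OF meas(1,3) sq(2,1,3) ceY]
      cond_exp_pair_residual_orthogonal[OF meas(1,2) sq(3,1,2) ceZ]
    show "(\<integral>\<omega>. T i \<omega> - (a i i + (\<Sum>j\<in>{1..3} - {i}. a i j * T j \<omega>)) \<partial>M) = 0"
      using i by cases (simp_all only: resid orth)
    fix k :: nat assume "k \<in> {1..3}" "k \<noteq> i"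
    then have "k = Suc 0 \<and> i \<noteq> Suc 0 \<or> k = 2 \<and> i \<noteq> 2 \<or> k = 3 \<and> i \<noteq> 3"
      by (auto simp: I)
    with i show "(\<integral>\<omega>. (T i \<omega> - (a i i + (\<Sum>j\<in>{1..3} - {i}. a i j * T j \<omega>))) * T k \<omega> \<partial>M) = 0"
      by cases (auto simp only: resid[unfolded T] orth T)
  qed simp
  \<comment> \<open>Each product occurs in both orders because elimination puts the coefficient from
    the regression of \<open>U\<close> first.\<close>
  have pairs: "1 - a 1 2 * a 2 1 > 0" "1 - a 2 1 * a 1 2 > 0" "1 - a 2 3 * a 3 2 > 0"
    "1 - a 3 2 * a 2 3 > 0" "1 - a 1 3 * a 3 1 > 0" "1 - a 3 1 * a 1 3 > 0"
    by (rule pair_minor_pos; simp)+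
  have mat: "mat_of_rows_list 3
      [[1, - a 1 2, - a 1 3], [- a 2 1, 1, - a 2 3], [- a 3 1, - a 3 2, 1]] = coeff_matrix 3 a"
    by (rule eq_matI)
      (auto simp: mat_of_rows_list_def coeff_matrix_def less_Suc_eq numeral_3_eq_3 numeral_2_eq_2)
  \<comment> \<open>For each ordered pair the third variable is the one eliminated.\<close>
  have "\<exists>b c. AE \<omega> in M. cond_exp_given M V (count_space UNIV) (\<lambda>\<omega>. real (U \<omega>)) \<omega> = b + c * real (V \<omega>)"
    if "(U, V) \<in> {(X, Y), (X, Z), (Y, X), (Y, Z), (Z, X), (Z, Y)}" for U V
    using that
      cond_exp_pair_eliminate[OF meas(1,3,2) int(1,3,2) ceX' ceZ pairs(5)]
      cond_exp_pair_eliminate[OF meas(1,2,3) int(1,2,3) ceX ceY pairs(1)]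
      cond_exp_pair_eliminate[OF meas(2,3,1) int(2,3,1) ceY' ceZ' pairs(3)]
      cond_exp_pair_eliminate[OF meas(2,1,3) int(2,1,3) ceY ceX pairs(2)]
      cond_exp_pair_eliminate[OF meas(3,2,1) int(3,2,1) ceZ' ceY' pairs(4)]
      cond_exp_pair_eliminate[OF meas(3,1,2) int(3,1,2) ceZ ceX' pairs(6)]
    by blast
  then show ?case
    unfolding mat using pairs principal_minors_pos_coeff_matrix[OF refl] by blast
next
  case (2 n X a)
  interpret prob_space M
    by fact
  from 2 have sq: "sq_integrable M (X i)" if "i \<in> {1..n}" for i
    using that unfolding sq_integrable_def by blast
  from 2 have indep: "lin_indep_rvs M {1..n} X"
    by blast
  from 2 have ce: "AE \<omega> in M. cond_exp_family M X ({1..n} - {i}) (X i) \<omega>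
      = a i i + (\<Sum>j\<in>{1..n} - {i}. a i j * X j \<omega>)" if "i \<in> {1..n}" for i
    using that by blast
  interpret regression_system M "{1..n}" X a
    by (rule regression_system_family[OF finite_atLeastAtMost sq indep ce])
  have linear: "\<exists>b c. AE \<omega> in M. cond_exp_family M X ({1..n} - {i}) (X i) \<omega>
      = b + (\<Sum>j\<in>{1..n} - {i}. c j * X j \<omega>)" if "i \<in> {1..n}" for i
    by (intro exI[of _ "a i i"] exI[of _ "a i"] ce that)
  show ?case
  proof (intro conjI allI impI ballI)
    show "principal_minors_pos (coeff_matrix n a)"
      by (rule principal_minors_pos_coeff_matrix[OF refl])
    show "\<exists>b c. AE \<omega> in M. cond_exp_family M X (S - {i}) (X i) \<omega>
        = b + (\<Sum>j\<in>S - {i}. c j * X j \<omega>)" if "S \<subseteq> {1..n}" "i \<in> S" for S i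
      by (rule cond_exp_family_linear_subset[OF finite_atLeastAtMost sq indep linear that])
  qed
qed

end
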